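(* Let $G=\langle a_1,\dots,a_d\rangle$ be a spinal Hanoi towers group. Then the map $$\varepsilon: G\longrightarrow \prod_{j=1}^d \mathbb Z/o(a_j)\mathbb Z,\qquad \gamma=a_{i_1}^{r_1}a_{i_2}^{r_2}\cdots a_{i_k}^{r_k}\longmapsto\bigl(e_1(\gamma),\ldots,e_d(\gamma)\bigr)$$ is a well-defined surjective group homomorphism. Furthermore, $\ker(\varepsilon)=G'$ and $$G/G'\cong\prod_{j=1}^d\mathbb Z/o(a_j)\mathbb Z.$$
   Context: $\mathcal T_d$ is the $d$-regular rooted tree whose vertices are the finite words over $\{1,\dots,d\}$. Automorphisms and permutations act on the right and products are read from left to right. For $g\in\mathrm{Aut}(\mathcal T_d)$ and a vertex $v$, the section $g|_v$ is defined by $(vw)^g=v^g\,w^{g|_v}$; we write $\psi(g)=(g|_1,\dots,g|_d)\tau$, where $\tau$ is the action of $g$ on the first level. Given $\sigma_1,\dots,\sigma_d\in\mathrm{Sym}(d)$ with $\sigma_i\neq 1$ and $\sigma_i$ fixing $i$ for each $i$, let $a_i\in\mathrm{Aut}(\mathcal T_d)$ be defined recursively by $\psi(a_i)=(1,\dots,1,a_i,1,\dots,1)\sigma_i$, with $a_i$ in the $i$-th coordinate. Any group $G=\langle a_1,\dots,a_d\rangle$ of this form is a spinal Hanoi towers group. The order $o(a_i)$ of $a_i$ is finite and equals the order of $\sigma_i$. A syllable form expression is a word $\gamma=a_{i_1}^{r_1}\cdots a_{i_k}^{r_k}$ ($k\ge 0$) with $i_j\ne i_{j+1}$ and $1\le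 r_j<o(a_{i_j})$. For such a word, $e_i(\gamma)\in\mathbb Z/o(a_i)\mathbb Z$ is the total exponent of $a_i$: $e_i(\gamma)=\sum_{t:\,i_t=i}r_t \bmod o(a_i)$. Well-definedness of $\varepsilon$ means that the value depends only on the element of $G$ that $\gamma$ represents. *)

theory Defs
  imports "HOL-Algebra.Algebra" "HOL-Combinatorics.Permutations"
begin

section \<open>The regular rooted tree and its automorphism group\<close>

definition words :: "nat \<Rightarrow> nat list set" where
  "words d = lists {1..d}"

definition tree_adj :: "nat \<Rightarrow> nat list \<Rightarrow> nat list \<Rightarrow> bool" where
  "tree_adj d v w \<longleftrightarrow>
     v \<in> words d \<and> w \<in> words d \<and> (\<exists>x. w = v @ [x] \<or> v = w @ [x])"

text \<open>Automorphisms act on the right and products are read from left to right, so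
  the product of \<open>g\<close> and \<open>h\<close> is ``first \<open>g\<close>, then \<open>h\<close>'', which is the opposite of the
  convention of \<^const>\<open>BijGroup\<close>.\<close>

definition aut_tree :: "nat \<Rightarrow> (nat list \<Rightarrow> nat list) monoid" where
  "aut_tree d =
     \<lparr>carrier = {g \<in> Bij (words d).
        g [] = [] \<and> (\<forall>v\<in>words d. \<forall>w\<in>words d. tree_adj d (g v) (g w) \<longleftrightarrow> tree_adj d v w)},
      monoid.mult = (\<lambda>g h. compose (words d) h g),
      one = (\<lambda>w\<in>words d. w)\<rparr>"

text \<open>For an automorphism \<open>g\<close> this is the unique solution of
  \<open>g (v @ w) = g v @ tree_section d g v w\<close>; see \<open>tree_section_eq\<close> below.\<close>

definition tree_section ::
  "nat \<Rightarrow> (nat list \<Rightarrow> nat list) \<Rightarrow> nat list \<Rightarrow> (nat list \<Rightarrow> nat list)" where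
  "tree_section d g v = (\<lambda>w\<in>words d. drop (length v) (g (v @ w)))"

text \<open>Extended by the identity outside \<open>{1..d}\<close>, as for \<^const>\<open>permutes\<close>.\<close>

definition level1_action :: "nat \<Rightarrow> (nat list \<Rightarrow> nat list) \<Rightarrow> nat \<Rightarrow> nat" where
  "level1_action d g x = (if x \<in> {1..d} then hd (g [x]) else x)"

definition psi ::
  "nat \<Rightarrow> (nat list \<Rightarrow> nat list) \<Rightarrow> (nat \<Rightarrow> (nat list \<Rightarrow> nat list)) \<times> (nat \<Rightarrow> nat)" where
  "psi d g = ((\<lambda>j\<in>{1..d}. tree_section d g [j]), level1_action d g)"


section \<open>Spinal Hanoi towers groups\<close>

text \<open>The recursion determines the automorphisms \<open>a i\<close> uniquely; they exist by
  \<open>spinal_hanoi_generators_exist\<close> below.\<close>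

definition spinal_hanoi_generators ::
  "nat \<Rightarrow> (nat \<Rightarrow> nat \<Rightarrow> nat) \<Rightarrow> (nat \<Rightarrow> (nat list \<Rightarrow> nat list)) \<Rightarrow> bool" where
  "spinal_hanoi_generators d \<sigma> a \<longleftrightarrow>
     (\<forall>i\<in>{1..d}. \<sigma> i permutes {1..d} \<and> \<sigma> i \<noteq> id \<and> \<sigma> i i = i) \<and>
     (\<forall>i\<in>{1..d}. a i \<in> carrier (aut_tree d) \<and>
        psi d (a i) = ((\<lambda>j\<in>{1..d}. if j = i then a i else \<one>\<^bsub>aut_tree d\<^esub>), \<sigma> i))"

definition spinal_hanoi_group ::
  "nat \<Rightarrow> (nat \<Rightarrow> (nat list \<Rightarrow> nat list)) \<Rightarrow> (nat list \<Rightarrow> nat list) monoid" where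
  "spinal_hanoi_group d a = subgroup_generated (aut_tree d) (a ` {1..d})"

definition gen_ord :: "nat \<Rightarrow> (nat \<Rightarrow> (nat list \<Rightarrow> nat list)) \<Rightarrow> nat \<Rightarrow> nat" where
  "gen_ord d a i = group.ord (aut_tree d) (a i)"

text \<open>The list \<open>[(i\<^sub>1, r\<^sub>1), \<dots>, (i\<^sub>k, r\<^sub>k)]\<close> stands for the formal word
  \<open>a\<^bsub>i\<^sub>1\<^esub>\<^bsup>r\<^sub>1\<^esup> \<dots> a\<^bsub>i\<^sub>k\<^esub>\<^bsup>r\<^sub>k\<^esup>\<close>.\<close>

definition syllable_form ::
  "nat \<Rightarrow> (nat \<Rightarrow> (nat list \<Rightarrow> nat list)) \<Rightarrow> (nat \<times> nat) list \<Rightarrow> bool" where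
  "syllable_form d a \<gamma> \<longleftrightarrow>
     (\<forall>(i, r)\<in>set \<gamma>. i \<in> {1..d} \<and> 1 \<le> r \<and> r < gen_ord d a i) \<and> distinct_adj (map fst \<gamma>)"

definition word_value ::
  "nat \<Rightarrow> (nat \<Rightarrow> (nat list \<Rightarrow> nat list)) \<Rightarrow> (nat \<times> nat) list \<Rightarrow> (nat list \<Rightarrow> nat list)" where
  "word_value d a \<gamma> =
     foldr (\<lambda>(i, r) g. (a i [^]\<^bsub>aut_tree d\<^esub> r) \<otimes>\<^bsub>aut_tree d\<^esub> g) \<gamma> \<one>\<^bsub>aut_tree d\<^esub>"

definition exponent_sum ::
  "nat \<Rightarrow> (nat \<Rightarrow> (nat list \<Rightarrow> nat list)) \<Rightarrow> nat \<Rightarrow> (nat \<times> nat) list \<Rightarrow> int" where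
  "exponent_sum d a j \<gamma> =
     int (\<Sum>(i, r)\<leftarrow>filter (\<lambda>(i, r). i = j) \<gamma>. r) mod int (gen_ord d a j)"

definition exponent_vector ::
  "nat \<Rightarrow> (nat \<Rightarrow> (nat list \<Rightarrow> nat list)) \<Rightarrow> (nat \<times> nat) list \<Rightarrow> (nat \<Rightarrow> int)" where
  "exponent_vector d a \<gamma> = (\<lambda>j\<in>{1..d}. exponent_sum d a j \<gamma>)"

definition exponent_group ::
  "nat \<Rightarrow> (nat \<Rightarrow> (nat list \<Rightarrow> nat list)) \<Rightarrow> (nat \<Rightarrow> int) monoid" where
  "exponent_group d a = product_group {1..d} (\<lambda>j. integer_mod_group (gen_ord d a j))"

text \<open>This description is meaningful only when \<open>g\<close> is represented by some syllable form
  expression and all such expressions have the same exponent vector.\<close>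

definition abel_map ::
  "nat \<Rightarrow> (nat \<Rightarrow> (nat list \<Rightarrow> nat list)) \<Rightarrow> (nat list \<Rightarrow> nat list) \<Rightarrow> (nat \<Rightarrow> int)" where
  "abel_map d a g =
     (THE v. \<exists>\<gamma>. syllable_form d a \<gamma> \<and> word_value d a \<gamma> = g \<and> exponent_vector d a \<gamma> = v)"


section \<open>Basic facts about the definitions\<close>

lemma tree_adj_commute: "tree_adj d v w \<longleftrightarrow> tree_adj d w v"
  by (auto simp: tree_adj_def)

lemma Nil_in_words [simp]: "[] \<in> words d"
  by (simp add: words_def)

lemma Cons_in_words [simp]: "x # w \<in> words d \<longleftrightarrow> x \<in> {1..d} \<and> w \<in> words d"
  by (simp add: words_def)

lemma append_in_words [simp]: "v @ w \<in> words d \<longleftrightarrow> v \<in> words d \<and> w \<in> words d"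
  by (auto simp: words_def)

lemma aut_tree_carrier_iff:
  "g \<in> carrier (aut_tree d) \<longleftrightarrow> g \<in> Bij (words d) \<and> g [] = [] \<and>
     (\<forall>v\<in>words d. \<forall>w\<in>words d. tree_adj d (g v) (g w) \<longleftrightarrow> tree_adj d v w)"
  by (simp add: aut_tree_def)

lemma aut_tree_in_words:
  assumes "g \<in> carrier (aut_tree d)" "v \<in> words d" shows "g v \<in> words d"
  using assms by (auto simp: aut_tree_carrier_iff Bij_def bij_betw_def)

lemma group_aut_tree: "group (aut_tree d)"
proof (rule groupI)
  fix g h assume g: "g \<in> carrier (aut_tree d)" and h: "h \<in> carrier (aut_tree d)"
  show "g \<otimes>\<^bsub>aut_tree d\<^esub> h \<in> carrier (aut_tree d)"
    using g h aut_tree_in_words[OF g] compose_Bij[of h "words d" g]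
    by (auto simp: aut_tree_carrier_iff) (auto simp: aut_tree_def compose_def)
  fix k assume "k \<in> carrier (aut_tree d)"
  show "g \<otimes>\<^bsub>aut_tree d\<^esub> h \<otimes>\<^bsub>aut_tree d\<^esub> k = g \<otimes>\<^bsub>aut_tree d\<^esub> (h \<otimes>\<^bsub>aut_tree d\<^esub> k)"
    using aut_tree_in_words[OF g] by (auto simp: aut_tree_def compose_def)
next
  show "\<one>\<^bsub>aut_tree d\<^esub> \<in> carrier (aut_tree d)"
    by (simp add: aut_tree_def id_Bij)
next
  fix g assume g: "g \<in> carrier (aut_tree d)"
  then have B: "g \<in> Bij (words d)" by (simp add: aut_tree_carrier_iff)
  show "\<one>\<^bsub>aut_tree d\<^esub> \<otimes>\<^bsub>aut_tree d\<^esub> g = g"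
    using Bij_imp_extensional[OF B] by (auto simp: aut_tree_def compose_def extensional_def)
  let ?h = "\<lambda>w\<in>words d. inv_into (words d) g w"
  have bij: "bij_betw g (words d) (words d)" using B by (simp add: Bij_def)
  have gh: "g (?h w) = w" "?h w \<in> words d" if "w \<in> words d" for w
    using that bij by (auto simp: bij_betw_def f_inv_into_f inv_into_into)
  have hg: "?h (g w) = w" if "w \<in> words d" for w
    using that bij aut_tree_in_words[OF g] by (simp add: bij_betw_def)
  have "?h \<in> carrier (aut_tree d)"
    unfolding aut_tree_carrier_iff
  proof (intro conjI ballI)
    show "?h \<in> Bij (words d)" by (rule restrict_inv_into_Bij[OF B])
    show "?h [] = []" using hg[of "[]"] g by (simp add: aut_tree_carrier_iff)
    fix v w assume "v \<in> words d" "w \<in> words d"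
    then show "tree_adj d (?h v) (?h w) \<longleftrightarrow> tree_adj d v w"
      using gh[of v] gh[of w] g unfolding aut_tree_carrier_iff by metis
  qed
  moreover have "?h \<otimes>\<^bsub>aut_tree d\<^esub> g = \<one>\<^bsub>aut_tree d\<^esub>"
    using gh by (auto simp: aut_tree_def compose_def)
  ultimately show "\<exists>h\<in>carrier (aut_tree d). h \<otimes>\<^bsub>aut_tree d\<^esub> g = \<one>\<^bsub>aut_tree d\<^esub>" by blast
qed

lemma aut_tree_child:
  assumes g: "g \<in> carrier (aut_tree d)" and "v @ [x] \<in> words d"
  shows "\<exists>y. g (v @ [x]) = g v @ [y]"
  using assms(2)
proof (induction v arbitrary: x rule: rev_induct)
  case Nil
  then have "[x] \<in> words d" "tree_adj d [] [x]" by (simp_all add: tree_adj_def)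
  then have "tree_adj d (g []) (g [x])"
    using g Nil_in_words unfolding aut_tree_carrier_iff by blast
  then show ?case using g by (auto simp: aut_tree_carrier_iff tree_adj_def)
next
  case (snoc z u)
  then have w: "u \<in> words d" "u @ [z] \<in> words d" "(u @ [z]) @ [x] \<in> words d" by simp_all
  have "tree_adj d (u @ [z]) ((u @ [z]) @ [x])" using w unfolding tree_adj_def by blast
  then have adj: "tree_adj d (g (u @ [z])) (g ((u @ [z]) @ [x]))"
    using g w unfolding aut_tree_carrier_iff by blast
  obtain y where y: "g (u @ [z]) = g u @ [y]" using snoc.IH w(2) by blast
  have inj: "inj_on g (words d)" using g by (simp add: aut_tree_carrier_iff Bij_def bij_betw_def)
  have "g ((u @ [z]) @ [x]) \<noteq> g u"
    using inj_onD[OF inj _ w(3) w(1)] by auto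
  with adj y show ?case unfolding tree_adj_def by auto
qed

lemma tree_section_eq:
  assumes g: "g \<in> carrier (aut_tree d)" and v: "v \<in> words d" and "w \<in> words d"
  shows "g (v @ w) = g v @ tree_section d g v w"
proof -
  have "\<exists>u. g (v @ w) = g v @ u" if "w \<in> words d" for w
    using that
  proof (induction w rule: rev_induct)
    case (snoc x w)
    then show ?case using aut_tree_child[OF g, of "v @ w" x] v by auto
  qed simp
  moreover have "length (g v) = length v"
    using v
  proof (induction v rule: rev_induct)
    case Nil
    then show ?case using g by (simp add: aut_tree_carrier_iff)
  next
    case (snoc x v)
    then show ?case using aut_tree_child[OF g, of v x] by auto
  qed
  ultimately show ?thesis
    using assms(3) by (fastforce simp: tree_section_def)
qed

primrec spinal_fun :: "(nat \<Rightarrow> nat) \<Rightarrow> nat \<Rightarrow> nat list \<Rightarrow> nat list" where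
  "spinal_fun \<pi> i [] = []"
| "spinal_fun \<pi> i (x # w) = \<pi> x # (if x = i then spinal_fun \<pi> i w else w)"

lemma spinal_fun_in_words:
  assumes "\<pi> permutes {1..d}" "w \<in> words d"
  shows "spinal_fun \<pi> i w \<in> words d"
  using assms(2) permutes_in_image[OF assms(1)] by (induction w) auto

lemma spinal_fun_inverse:
  assumes "\<pi> permutes {1..d}" "\<pi> i = i"
  shows "spinal_fun (inv_into UNIV \<pi>) i (spinal_fun \<pi> i w) = w"
proof (induction w)
  case (Cons x w)
  have "\<pi> x = i \<longleftrightarrow> x = i"
    using assms(2) permutes_inj[OF assms(1)] by (metis injD)
  with Cons show ?case
    using permutes_inverses[OF assms(1)] by auto
qed simp

lemma spinal_fun_snoc: "\<exists>y. spinal_fun \<pi> i (w @ [x]) = spinal_fun \<pi> i w @ [y]"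
  by (induction w) auto

lemma spinal_fun_adj:
  assumes "\<pi> permutes {1..d}" "tree_adj d v w"
  shows "tree_adj d (spinal_fun \<pi> i v) (spinal_fun \<pi> i w)"
  using assms spinal_fun_in_words[OF assms(1)] spinal_fun_snoc[of \<pi> i]
  unfolding tree_adj_def by metis

lemma spinal_fun_aut:
  assumes p: "\<pi> permutes {1..d}" and fx: "\<pi> i = i"
  shows "(\<lambda>w\<in>words d. spinal_fun \<pi> i w) \<in> carrier (aut_tree d)"
proof -
  let ?f = "spinal_fun \<pi> i" and ?g = "spinal_fun (inv_into UNIV \<pi>) i"
  have q: "inv_into UNIV \<pi> permutes {1..d}" and fixq: "inv_into UNIV \<pi> i = i"
    using p fx by (auto simp: permutes_inv permutes_inv_eq)
  have gf: "?g (?f w) = w" for w by (rule spinal_fun_inverse[OF p fx])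
  have fg: "?f (?g w) = w" for w
    using spinal_fun_inverse[OF q fixq] by (simp add: permutes_inv_inv[OF p])
  have bij: "bij_betw ?f (words d) (words d)"
    by (rule bij_betw_byWitness[where f' = ?g])
       (auto simp: gf fg intro: spinal_fun_in_words p q)
  have adj: "tree_adj d (?f v) (?f w) \<longleftrightarrow> tree_adj d v w" for v w
    using spinal_fun_adj[OF p, of v w i] spinal_fun_adj[OF q, of "?f v" "?f w" i] by (auto simp: gf)
  show ?thesis
    using bij adj by (auto simp: aut_tree_carrier_iff Bij_def cong: bij_betw_cong)
qed

lemma spinal_hanoi_generators_exist:
  assumes "\<forall>i\<in>{1..d}. \<sigma> i permutes {1..d} \<and> \<sigma> i \<noteq> id \<and> \<sigma> i i = i"
  shows "spinal_hanoi_generators d \<sigma> (\<lambda>i. \<lambda>w\<in>words d. spinal_fun (\<sigma> i) i w)"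
  unfolding spinal_hanoi_generators_def
proof (intro conjI ballI)
  fix i assume i: "i \<in> {1..d}"
  then have p: "\<sigma> i permutes {1..d}" "\<sigma> i i = i" using assms by auto
  let ?a = "\<lambda>w\<in>words d. spinal_fun (\<sigma> i) i w"
  show "?a \<in> carrier (aut_tree d)" by (rule spinal_fun_aut[OF p])
  have "tree_section d ?a [j] = (if j = i then ?a else \<one>\<^bsub>aut_tree d\<^esub>)" if "j \<in> {1..d}" for j
    using that by (auto simp: tree_section_def aut_tree_def fun_eq_iff)
  moreover have "level1_action d ?a = \<sigma> i"
    using permutes_not_in[OF p(1)] by (auto simp: level1_action_def fun_eq_iff)
  ultimately show "psi d ?a = ((\<lambda>j\<in>{1..d}. if j = i then ?a else \<one>\<^bsub>aut_tree d\<^esub>), \<sigma> i)"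
    by (auto simp: psi_def cong: restrict_cong)
qed (use assms in auto)

end

theory Submission
  imports Defs
begin

text \<open>
  The heart of the matter is that \<open>\<epsilon>\<close> is well defined: a word in the generators that represents
  the identity must have each exponent sum divisible by the order of the corresponding
  generator.  Everything is done with words in the positive letters \<open>a\<^sub>1, \<dots>, a\<^sub>d\<close>;
  the generators have finite order, so these words represent all of \<open>G\<close>.

  The section of a word at a first-level vertex \<open>x\<close> is again a word.  Reading the
  word from left to right, one follows the orbit of \<open>x\<close> and records the letter \<open>a\<^sub>i\<close>
  exactly when the current point is \<open>i\<close>, since all other sections of \<open>a\<^sub>i\<close> are trivial.  At
  each time the \<open>d\<close> orbits occupy the \<open>d\<close> points bijectively, so each letter is recorded by
  exactly one \<open>x\<close>, and the exponent sums of the \<open>d\<close> sections add up to those of the word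
  (\<open>sum_count_sections\<close>).  If the word is trivial, so are its sections.  When all of them are
  shorter than the word, induction on the length finishes the argument.  Otherwise some
  section at \<open>x\<close> records every letter; as \<open>\<sigma>\<^sub>x\<close> fixes \<open>x\<close>, the orbit never leaves \<open>x\<close>, so the
  word is a power of \<open>a\<^sub>x\<close> (\<open>full_section_imp_power\<close>) and the order of \<open>a\<^sub>x\<close> divides its
  length.  This is \<open>trivial_word_exponents\<close>.

  The rest is formal.  Concatenation of words adds exponent sums, which makes \<open>\<epsilon>\<close> a
  homomorphism, and it is visibly surjective.  Its target is abelian, so its kernel contains
  \<open>G'\<close>.  Conversely, the image of a word in the abelian group \<open>G/G'\<close> is the product of the
  images of the \<open>a\<^sub>j\<close> raised to the exponent sums (\<open>hom_letter_value\<close>), and so it vanishes as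
  soon as these are divisible by the orders.
\<close>

section \<open>Letter words and their sections\<close>

locale spinal_hanoi =
  fixes d :: nat
    and \<sigma> :: "nat \<Rightarrow> nat \<Rightarrow> nat"
    and a :: "nat \<Rightarrow> (nat list \<Rightarrow> nat list)"
  assumes gens: "spinal_hanoi_generators d \<sigma> a"
begin

sublocale T: group "aut_tree d"
  by (rule group_aut_tree)

abbreviation N :: "nat \<Rightarrow> nat" where "N \<equiv> gen_ord d a"

definition letter_value :: "nat list \<Rightarrow> (nat list \<Rightarrow> nat list)" where
  "letter_value w = foldr (\<lambda>i g. a i \<otimes>\<^bsub>aut_tree d\<^esub> g) w \<one>\<^bsub>aut_tree d\<^esub>"

definition letter_action :: "nat list \<Rightarrow> nat \<Rightarrow> nat" where
  "letter_action w x = foldl (\<lambda>y i. \<sigma> i y) x w"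

text \<open>In the first case the orbit stays at \<open>x\<close> because \<open>\<sigma> i\<close> fixes \<open>i\<close>.\<close>

fun letter_section :: "nat list \<Rightarrow> nat \<Rightarrow> nat list" where
  "letter_section [] x = []"
| "letter_section (i # w) x =
     (if x = i then i # letter_section w x else letter_section w (\<sigma> i x))"

lemma letter_value_simps [simp]:
  "letter_value [] = \<one>\<^bsub>aut_tree d\<^esub>"
  "letter_value (i # w) = a i \<otimes>\<^bsub>aut_tree d\<^esub> letter_value w"
  by (simp_all add: letter_value_def)

lemma letter_action_simps [simp]:
  "letter_action [] x = x"
  "letter_action (i # w) x = letter_action w (\<sigma> i x)"
  by (simp_all add: letter_action_def)

lemma sigma:
  assumes "i \<in> {1..d}"
  shows "\<sigma> i permutes {1..d}" "\<sigma> i \<noteq> id" "\<sigma> i i = i"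
  using gens assms by (auto simp: spinal_hanoi_generators_def)

lemma sigma_in: "i \<in> {1..d} \<Longrightarrow> x \<in> {1..d} \<Longrightarrow> \<sigma> i x \<in> {1..d}"
  by (meson permutes_in_image sigma(1))

lemma gen_closed: "i \<in> {1..d} \<Longrightarrow> a i \<in> carrier (aut_tree d)"
  using gens by (auto simp: spinal_hanoi_generators_def)

lemma letter_value_closed: "set w \<subseteq> {1..d} \<Longrightarrow> letter_value w \<in> carrier (aut_tree d)"
  by (induction w) (auto intro!: T.m_closed gen_closed)

lemma letter_value_append:
  "set w \<subseteq> {1..d} \<Longrightarrow> set w' \<subseteq> {1..d} \<Longrightarrow>
     letter_value (w @ w') = letter_value w \<otimes>\<^bsub>aut_tree d\<^esub> letter_value w'"
proof (induction w)
  case Nil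
  then show ?case using letter_value_closed[of w'] by simp
next
  case (Cons i w)
  then show ?case
    using T.m_assoc[OF gen_closed letter_value_closed letter_value_closed, of i w w'] by simp
qed

lemma letter_value_replicate:
  "i \<in> {1..d} \<Longrightarrow> letter_value (replicate n i) = a i [^]\<^bsub>aut_tree d\<^esub> n"
proof (induction n)
  case (Suc n)
  then show ?case using T.nat_pow_Suc2[OF gen_closed] by simp
qed simp

text \<open>The wreath recursion of \<open>a i\<close>, read as a rule for computing on words of the tree.\<close>

lemma gen_apply:
  assumes i: "i \<in> {1..d}" and x: "x \<in> {1..d}" and v: "v \<in> words d"
  shows "a i (x # v) = \<sigma> i x # (if x = i then a i v else v)"
proof -
  have ai: "a i \<in> carrier (aut_tree d)" using gen_closed[OF i] .
  have psi: "psi d (a i) = ((\<lambda>j\<in>{1..d}. if j = i then a i else \<one>\<^bsub>aut_tree d\<^esub>), \<sigma> i)"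
    using gens i unfolding spinal_hanoi_generators_def by blast
  have sec: "tree_section d (a i) [x] = (if x = i then a i else \<one>\<^bsub>aut_tree d\<^esub>)"
    using fun_cong[OF arg_cong[OF psi, of fst], of x] x by (simp add: psi_def)
  have hd: "hd (a i [x]) = \<sigma> i x"
    using fun_cong[OF arg_cong[OF psi, of snd], of x] x by (simp add: psi_def level1_action_def)
  obtain y where "a i [x] = [y]"
    using aut_tree_child[OF ai, of "[]" x] x ai by (auto simp: aut_tree_carrier_iff)
  with hd have "a i [x] = [\<sigma> i x]" by simp
  then show ?thesis
    using tree_section_eq[OF ai, of "[x]" v] x v sec by (auto simp: aut_tree_def)
qed

lemma letter_value_apply:
  assumes "set w \<subseteq> {1..d}" "x \<in> {1..d}" "v \<in> words d"
  shows "letter_value w (x # v) = letter_action w x # letter_value (letter_section w x) v"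
  using assms
proof (induction w arbitrary: x v)
  case Nil
  then show ?case by (simp add: aut_tree_def)
next
  case (Cons i w)
  then have i: "i \<in> {1..d}" and w: "set w \<subseteq> {1..d}" by auto
  have mult: "(a i \<otimes>\<^bsub>aut_tree d\<^esub> h) u = h (a i u)" if "u \<in> words d" for h u
    using that by (simp add: aut_tree_def compose_def)
  have "a i v \<in> words d" using aut_tree_in_words[OF gen_closed[OF i]] Cons.prems by simp
  then show ?case
    using Cons.IH[OF w] Cons.prems sigma_in[OF i, of x] sigma(3)[OF i] i
    by (auto simp: mult gen_apply)
qed

lemma letter_section_letters: "set w \<subseteq> {1..d} \<Longrightarrow> set (letter_section w x) \<subseteq> {1..d}"
  by (induction w x rule: letter_section.induct) auto

text \<open>The subtree below \<open>x\<close> is moved by the section only, so it is fixed pointwise.\<close>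

lemma section_of_trivial_word:
  assumes w: "set w \<subseteq> {1..d}" and x: "x \<in> {1..d}"
    and triv: "letter_value w = \<one>\<^bsub>aut_tree d\<^esub>"
  shows "letter_value (letter_section w x) = \<one>\<^bsub>aut_tree d\<^esub>"
proof
  fix v
  have closed: "letter_value (letter_section w x) \<in> carrier (aut_tree d)"
    using letter_value_closed letter_section_letters w by blast
  show "letter_value (letter_section w x) v = \<one>\<^bsub>aut_tree d\<^esub> v"
  proof (cases "v \<in> words d")
    case True
    have "letter_value w (x # v) = x # v" using triv x True by (simp add: aut_tree_def)
    then show ?thesis using letter_value_apply[OF w x True] True by (simp add: aut_tree_def)
  next
    case False
    then show ?thesis
      using closed by (auto simp: aut_tree_carrier_iff aut_tree_def Bij_def extensional_def)
  qed
qed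


section \<open>Exponent sums of trivial words\<close>

text \<open>The first letter \<open>i\<close> is recorded only at \<open>x = i\<close>; the remaining letters are read from the
  points \<open>\<sigma> i x\<close>, and these run through \<open>{1..d}\<close> as \<open>x\<close> does.\<close>

lemma sum_count_sections:
  "set w \<subseteq> {1..d} \<Longrightarrow> (\<Sum>x\<in>{1..d}. count_list (letter_section w x) j) = count_list w j"
proof (induction w)
  case (Cons i w)
  then have i: "i \<in> {1..d}" by simp
  have "count_list (letter_section (i # w) x) j =
      (if x = i then if i = j then 1 else 0 else 0) + count_list (letter_section w (\<sigma> i x)) j" for x
    using sigma(3)[OF i] by auto
  then have "(\<Sum>x\<in>{1..d}. count_list (letter_section (i # w) x) j) =
      (\<Sum>x\<in>{1..d}. if x = i then if i = j then 1 else 0 else 0) +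
      (\<Sum>x\<in>{1..d}. count_list (letter_section w (\<sigma> i x)) j)"
    by (simp add: sum.distrib)
  also have "(\<Sum>x\<in>{1..d}. count_list (letter_section w (\<sigma> i x)) j) =
      (\<Sum>x\<in>{1..d}. count_list (letter_section w x) j)"
    using sum.permute[OF sigma(1)[OF i], of "\<lambda>x. count_list (letter_section w x) j"]
    by (simp add: comp_def)
  also have "(\<Sum>x\<in>{1..d}. if x = i then if i = j then 1 else 0 else 0) = (if i = j then 1 else (0::nat))"
    using i by simp
  finally show ?case using Cons by simp
qed simp

lemma length_letter_section: "length (letter_section w x) \<le> length w"
  by (induction w x rule: letter_section.induct) auto

text \<open>The first letter is not recorded at \<open>x\<close> unless it is \<open>x\<close> itself, and then the orbit stays
  at \<open>x\<close>.  A single unrecorded letter already makes the section shorter.\<close>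

lemma full_section_imp_power:
  "length (letter_section w x) = length w \<Longrightarrow> w = replicate (length w) x"
proof (induction w)
  case (Cons i w)
  have "x = i"
    using Cons.prems length_letter_section[of w "\<sigma> i x"] by (auto split: if_splits)
  then show ?case using Cons by simp
qed simp

lemma count_list_replicate: "count_list (replicate n x) y = (if x = y then n else 0)"
  by (induction n) auto

text \<open>Induction on the length: passing to sections keeps the exponent sums in total, and it fails
  to shorten the word only for powers of a single generator.\<close>

lemma trivial_word_exponents:
  assumes "set w \<subseteq> {1..d}" "letter_value w = \<one>\<^bsub>aut_tree d\<^esub>"
  shows "N j dvd count_list w j"
  using assms
proof (induction w rule: length_induct)
  case (1 w)
  show ?case
  proof (cases "\<exists>x\<in>{1..d}. length (letter_section w x) = length w")
    case True
    then obtain x where x: "x \<in> {1..d}" "w = replicate (length w) x"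
      using full_section_imp_power by blast
    then have "a x [^]\<^bsub>aut_tree d\<^esub> length w = \<one>\<^bsub>aut_tree d\<^esub>"
      using "1.prems"(2) letter_value_replicate by metis
    then have "N x dvd length w"
      unfolding gen_ord_def using T.pow_eq_id[OF gen_closed[OF x(1)]] by simp
    then show ?thesis using x(2) count_list_replicate by (metis dvd_0_right)
  next
    case False
    have "N j dvd count_list (letter_section w x) j" if x: "x \<in> {1..d}" for x
    proof -
      have "length (letter_section w x) < length w"
        using False x length_letter_section[of w x] by (simp add: order_less_le)
      then show ?thesis
        using 1 x letter_section_letters section_of_trivial_word by blast
    qed
    then show ?thesis
      using sum_count_sections[OF "1.prems"(1), of j] dvd_sum by metis
  qed
qed


section \<open>Orders of the generators\<close>

lemma letter_action_replicate: "letter_action (replicate n i) x = (\<sigma> i ^^ n) x"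
  by (induction n arbitrary: x) (auto simp: funpow_swap1)

lemma letter_section_replicate:
  assumes i: "i \<in> {1..d}"
  shows "letter_section (replicate n i) x = (if x = i then replicate n i else [])"
proof (induction n arbitrary: x)
  case (Suc n)
  have "\<sigma> i x = i \<longleftrightarrow> x = i"
    using sigma(3)[OF i] permutes_inj[OF sigma(1)[OF i]] by (metis injD)
  with Suc show ?case by simp
qed simp

text \<open>The power \<open>a i ^ n\<close> acts on the first level by \<open>\<sigma> i ^ n\<close>, has itself as section at \<open>i\<close>
  and trivial sections elsewhere; so if \<open>\<sigma> i ^ n\<close> is the identity, no level is moved.\<close>

lemma gen_power_eq_one:
  assumes i: "i \<in> {1..d}" and n: "\<sigma> i ^^ n = id"
  shows "a i [^]\<^bsub>aut_tree d\<^esub> n = \<one>\<^bsub>aut_tree d\<^esub>"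
proof -
  let ?w = "replicate n i"
  have w: "set ?w \<subseteq> {1..d}" using i by auto
  have fixes_words: "letter_value ?w v = v" if "v \<in> words d" for v
    using that
  proof (induction v)
    case Nil
    then show ?case using letter_value_closed[OF w] by (simp add: aut_tree_carrier_iff)
  next
    case (Cons x v)
    then have "x \<in> {1..d}" "v \<in> words d" by simp_all
    then show ?case
      using letter_value_apply[OF w] Cons.IH n
      by (auto simp: letter_action_replicate letter_section_replicate[OF i] aut_tree_def)
  qed
  have "letter_value ?w v = \<one>\<^bsub>aut_tree d\<^esub> v" for v
    using fixes_words[of v] letter_value_closed[OF w]
    by (cases "v \<in> words d") (auto simp: aut_tree_carrier_iff aut_tree_def Bij_def extensional_def)
  then show ?thesis by (simp add: letter_value_replicate[OF i, symmetric] fun_eq_iff)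
qed

text \<open>A positive power of \<open>\<sigma> i\<close> is the identity, so \<open>a i\<close> has finite order (the value \<open>0\<close> would
  stand for infinite order); and \<open>a i\<close> is nontrivial because \<open>\<sigma> i\<close> is.\<close>

lemma gen_ord_gt_1:
  assumes i: "i \<in> {1..d}"
  shows "1 < N i"
proof -
  have "permutation (\<sigma> i)"
    using sigma(1)[OF i] permutation_permutes by blast
  then obtain n where n: "\<sigma> i ^^ n = id" "n > 0"
    using permutation_is_nilpotent by blast
  then have "N i dvd n"
    unfolding gen_ord_def using gen_power_eq_one[OF i] T.pow_eq_id[OF gen_closed[OF i]] by blast
  then have "N i \<noteq> 0" using n by (metis dvd_0_left_iff less_irrefl)
  moreover have "N i \<noteq> 1"
  proof
    assume "N i = 1"
    then have one: "a i = \<one>\<^bsub>aut_tree d\<^esub>"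
      unfolding gen_ord_def using T.ord_eq_1[OF gen_closed[OF i]] by simp
    have "\<sigma> i x = x" for x
    proof (cases "x \<in> {1..d}")
      case True
      have "a i [x] = [x]" using True by (simp add: one aut_tree_def)
      then show ?thesis using gen_apply[OF i True, of "[]"] by simp
    qed (use permutes_not_in[OF sigma(1)[OF i]] in simp)
    then show False using sigma(2)[OF i] by (simp add: fun_eq_iff)
  qed
  ultimately show ?thesis by simp
qed

lemma gen_pow_ord: "i \<in> {1..d} \<Longrightarrow> a i [^]\<^bsub>aut_tree d\<^esub> N i = \<one>\<^bsub>aut_tree d\<^esub>"
  unfolding gen_ord_def using T.pow_ord_eq_1 gen_closed by blast


section \<open>Exponent vectors of group elements\<close>

text \<open>Since \<open>a i\<close> has finite order, its inverse is the positive word \<open>a i ^ (N i - 1)\<close>.\<close>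

lemma inverse_word_exists:
  "set w \<subseteq> {1..d} \<Longrightarrow>
     \<exists>w'. set w' \<subseteq> {1..d} \<and> letter_value w \<otimes>\<^bsub>aut_tree d\<^esub> letter_value w' = \<one>\<^bsub>aut_tree d\<^esub>"
proof (induction w)
  case Nil
  then show ?case by (intro exI[of _ "[]"]) simp
next
  case (Cons i w)
  then obtain w' where w': "set w' \<subseteq> {1..d}"
      "letter_value w \<otimes>\<^bsub>aut_tree d\<^esub> letter_value w' = \<one>\<^bsub>aut_tree d\<^esub>" by auto
  have i: "i \<in> {1..d}" using Cons.prems by simp
  let ?p = "replicate (N i - 1) i"
  have p: "set ?p \<subseteq> {1..d}" using i by auto
  have "i # ?p = replicate (N i) i"
    using gen_ord_gt_1[OF i] by (cases "N i") simp_all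
  then have "letter_value (i # ?p) = \<one>\<^bsub>aut_tree d\<^esub>"
    by (simp only: letter_value_replicate[OF i] gen_pow_ord[OF i])
  then have ip: "a i \<otimes>\<^bsub>aut_tree d\<^esub> letter_value ?p = \<one>\<^bsub>aut_tree d\<^esub>"
    by (simp only: letter_value_simps)
  have w: "set w \<subseteq> {1..d}" using Cons.prems by simp
  note closed = gen_closed[OF i] letter_value_closed[OF w] letter_value_closed[OF w'(1)]
    letter_value_closed[OF p]
  have "letter_value (i # w) \<otimes>\<^bsub>aut_tree d\<^esub> letter_value (w' @ ?p) =
      a i \<otimes>\<^bsub>aut_tree d\<^esub> (letter_value w \<otimes>\<^bsub>aut_tree d\<^esub> letter_value w') \<otimes>\<^bsub>aut_tree d\<^esub> letter_value ?p"
    using closed by (simp add: letter_value_append[OF w'(1) p] T.m_assoc del: One_nat_def)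
  also have "\<dots> = \<one>\<^bsub>aut_tree d\<^esub>"
    unfolding w'(2) using ip closed(1) by simp
  finally show ?case using w' p by (intro exI[of _ "w' @ ?p"]) auto
qed

text \<open>If \<open>u\<close> spells the inverse of the common value, then \<open>w @ u\<close> and \<open>w' @ u\<close> are both trivial
  words.\<close>

lemma letter_value_eq_imp_cong:
  assumes "set w \<subseteq> {1..d}" "set w' \<subseteq> {1..d}" "letter_value w = letter_value w'"
  shows "int (count_list w j) mod int (N j) = int (count_list w' j) mod int (N j)"
proof -
  obtain u where u: "set u \<subseteq> {1..d}"
      "letter_value w \<otimes>\<^bsub>aut_tree d\<^esub> letter_value u = \<one>\<^bsub>aut_tree d\<^esub>"
    using inverse_word_exists[OF assms(1)] by blast
  have dvd: "int (N j) dvd int (count_list v j) + int (count_list u j)"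
    if "set v \<subseteq> {1..d}" "letter_value v = letter_value w" for v
  proof -
    have "letter_value (v @ u) = \<one>\<^bsub>aut_tree d\<^esub>"
      by (simp only: letter_value_append[OF that(1) u(1)] that(2) u(2))
    then have "N j dvd count_list (v @ u) j"
      using that(1) u(1) by (intro trivial_word_exponents) simp_all
    then show ?thesis by (simp flip: of_nat_add)
  qed
  have "int (N j) dvd int (count_list w j) - int (count_list w' j)"
    using dvd_diff[OF dvd[OF assms(1) refl] dvd[OF assms(2) assms(3)[symmetric]]] by simp
  then show ?thesis by (simp add: mod_eq_dvd_iff)
qed

definition letters_of :: "(nat \<times> nat) list \<Rightarrow> nat list" where
  "letters_of \<gamma> = concat (map (\<lambda>(i, r). replicate r i) \<gamma>)"

lemma letters_of_simps [simp]:
  "letters_of [] = []"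
  "letters_of ((i, r) # \<gamma>) = replicate r i @ letters_of \<gamma>"
  by (simp_all add: letters_of_def)

lemma syllable_form_simps [simp]:
  "syllable_form d a []"
  "syllable_form d a ((i, r) # \<gamma>) \<longleftrightarrow>
     i \<in> {1..d} \<and> 1 \<le> r \<and> r < N i \<and> (\<gamma> = [] \<or> i \<noteq> fst (hd \<gamma>)) \<and> syllable_form d a \<gamma>"
  by (auto simp: syllable_form_def distinct_adj_Cons hd_map)

lemma letters_of_syllable_form:
  assumes "syllable_form d a \<gamma>"
  shows "set (letters_of \<gamma>) \<subseteq> {1..d}" "letter_value (letters_of \<gamma>) = word_value d a \<gamma>"
proof -
  show letters: "set (letters_of \<gamma>) \<subseteq> {1..d}"
    using assms by (auto simp: letters_of_def syllable_form_def)
  show "letter_value (letters_of \<gamma>) = word_value d a \<gamma>"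
    using assms letters
  proof (induction \<gamma>)
    case (Cons s \<gamma>)
    obtain i r where "s = (i, r)" by fastforce
    with Cons show ?case
      by (auto simp: letter_value_append letter_value_replicate word_value_def)
  qed (simp add: word_value_def)
qed

lemma exponent_sum_letters_of:
  "exponent_sum d a j \<gamma> = int (count_list (letters_of \<gamma>) j) mod int (N j)"
proof -
  have "(\<Sum>(i, r)\<leftarrow>filter (\<lambda>(i, r). i = j) \<gamma>. r) = count_list (letters_of \<gamma>) j"
    by (induction \<gamma>) (auto simp: count_list_replicate)
  then show ?thesis by (simp add: exponent_sum_def)
qed

definition exponents :: "nat list \<Rightarrow> nat \<Rightarrow> int" where
  "exponents w = (\<lambda>j\<in>{1..d}. int (count_list w j) mod int (N j))"

lemma exponents_cong:
  assumes "set w \<subseteq> {1..d}" "set w' \<subseteq> {1..d}" "letter_value w = letter_value w'"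
  shows "exponents w = exponents w'"
  unfolding exponents_def using letter_value_eq_imp_cong[OF assms] by simp

lemma exponent_vector_letters_of: "exponent_vector d a \<gamma> = exponents (letters_of \<gamma>)"
  by (simp add: exponent_vector_def exponents_def exponent_sum_letters_of)

lemma exponent_vector_well_defined:
  assumes "syllable_form d a \<gamma>" "syllable_form d a \<gamma>'" "word_value d a \<gamma> = word_value d a \<gamma>'"
  shows "exponent_vector d a \<gamma> = exponent_vector d a \<gamma>'"
  unfolding exponent_vector_letters_of
  using assms letters_of_syllable_form by (intro exponents_cong) auto

text \<open>Letters are multiplied on from the left.  A letter that equals the base of the first
  syllable is absorbed into it, and the syllable disappears when its exponent reaches the
  order, leaving a tail that is already in syllable form.\<close>

lemma syllable_form_exists:
  "set w \<subseteq> {1..d} \<Longrightarrow> \<exists>\<gamma>. syllable_form d a \<gamma> \<and> word_value d a \<gamma> = letter_value w"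
proof (induction w)
  case Nil
  then show ?case by (intro exI[of _ "[]"]) (simp add: word_value_def)
next
  case (Cons i w)
  then obtain \<gamma> where \<gamma>: "syllable_form d a \<gamma>" "word_value d a \<gamma> = letter_value w" by auto
  have i: "i \<in> {1..d}" using Cons.prems by simp
  note ai = gen_closed[OF i]
  have val: "word_value d a ((k, r) # \<delta>) =
      a k [^]\<^bsub>aut_tree d\<^esub> r \<otimes>\<^bsub>aut_tree d\<^esub> word_value d a \<delta>" for k r \<delta>
    by (simp add: word_value_def)
  have closed: "word_value d a \<delta> \<in> carrier (aut_tree d)" if "syllable_form d a \<delta>" for \<delta>
    using letters_of_syllable_form[OF that] letter_value_closed by metis
  show ?case
  proof (cases "\<gamma> = [] \<or> i \<noteq> fst (hd \<gamma>)")
    case True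
    then show ?thesis
      using \<gamma> i ai gen_ord_gt_1[OF i] by (intro exI[of _ "(i, 1) # \<gamma>"]) (simp add: val)
  next
    case False
    then obtain r \<delta> where \<gamma>_eq: "\<gamma> = (i, r) # \<delta>" by (cases \<gamma>) auto
    then have \<delta>: "syllable_form d a \<delta>" and r: "r < N i" using \<gamma>(1) by auto
    have new: "letter_value (i # w) =
        a i [^]\<^bsub>aut_tree d\<^esub> Suc r \<otimes>\<^bsub>aut_tree d\<^esub> word_value d a \<delta>"
      using ai closed[OF \<delta>]
      unfolding T.nat_pow_Suc2[OF ai] letter_value_simps \<gamma>(2)[symmetric] \<gamma>_eq val
      by (simp add: T.m_assoc)
    show ?thesis
    proof (cases "Suc r = N i")
      case True
      then have "letter_value (i # w) = word_value d a \<delta>"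
        using new gen_pow_ord[OF i] closed[OF \<delta>] by simp
      then show ?thesis using \<delta> by metis
    next
      case False
      then have "syllable_form d a ((i, Suc r) # \<delta>)" using \<gamma>(1) r \<gamma>_eq by simp
      then show ?thesis using new val by metis
    qed
  qed
qed

lemma abel_map_letter_value:
  assumes "set w \<subseteq> {1..d}"
  shows "abel_map d a (letter_value w) = exponents w"
proof -
  have eq: "exponent_vector d a \<gamma> = exponents w"
    if "syllable_form d a \<gamma>" "word_value d a \<gamma> = letter_value w" for \<gamma>
    unfolding exponent_vector_letters_of
    using that assms letters_of_syllable_form by (intro exponents_cong) auto
  show ?thesis
    unfolding abel_map_def using syllable_form_exists[OF assms] eq
    by (intro the_equality) blast+
qed

section \<open>The exponent homomorphism\<close>

abbreviation "G \<equiv> spinal_hanoi_group d a"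
abbreviation "E \<equiv> exponent_group d a"

lemma group_G: "group G"
  by (simp add: spinal_hanoi_group_def)

lemma mult_G [simp]: "(\<otimes>\<^bsub>G\<^esub>) = (\<otimes>\<^bsub>aut_tree d\<^esub>)"
  and one_G [simp]: "\<one>\<^bsub>G\<^esub> = \<one>\<^bsub>aut_tree d\<^esub>"
  by (simp_all add: spinal_hanoi_group_def)

lemma gen_in_G: "i \<in> {1..d} \<Longrightarrow> a i \<in> carrier G"
  using gen_closed by (auto simp: spinal_hanoi_group_def carrier_subgroup_generated intro!: generate.incl)

lemma carrier_G: "carrier G = letter_value ` {w. set w \<subseteq> {1..d}}" (is "_ = ?L")
proof
  have "letter_value w \<in> carrier G" if "set w \<subseteq> {1..d}" for w
    using that
  proof (induction w)
    case Nil
    then show ?case using monoid.one_closed[OF group.is_monoid[OF group_G]] by simp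
  next
    case (Cons i w)
    then show ?case using monoid.m_closed[OF group.is_monoid[OF group_G]] gen_in_G by simp
  qed
  then show "?L \<subseteq> carrier G" by blast
  have "subgroup ?L (aut_tree d)"
  proof (rule T.subgroupI)
    show "?L \<subseteq> carrier (aut_tree d)" using letter_value_closed by blast
    have "letter_value [] \<in> ?L" by (intro imageI) simp
    then show "?L \<noteq> {}" by blast
    fix g assume "g \<in> ?L"
    then obtain w where w: "set w \<subseteq> {1..d}" "g = letter_value w" by blast
    obtain w' where w': "set w' \<subseteq> {1..d}"
        "letter_value w \<otimes>\<^bsub>aut_tree d\<^esub> letter_value w' = \<one>\<^bsub>aut_tree d\<^esub>"
      using inverse_word_exists[OF w(1)] by blast
    note closed = letter_value_closed[OF w(1)] letter_value_closed[OF w'(1)]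
    have "inv\<^bsub>aut_tree d\<^esub> g = letter_value w'"
      unfolding w(2) using T.inv_equality[OF T.inv_comm[OF w'(2) closed] closed] .
    then show "inv\<^bsub>aut_tree d\<^esub> g \<in> ?L" using w'(1) by blast
    fix h assume "h \<in> ?L"
    then obtain u where u: "set u \<subseteq> {1..d}" "h = letter_value u" by blast
    have "g \<otimes>\<^bsub>aut_tree d\<^esub> h = letter_value (w @ u)"
      by (simp only: w(2) u(2) letter_value_append[OF w(1) u(1)])
    moreover have "set (w @ u) \<subseteq> {1..d}" using w(1) u(1) by simp
    ultimately show "g \<otimes>\<^bsub>aut_tree d\<^esub> h \<in> ?L" by blast
  qed
  moreover have "a ` {1..d} \<subseteq> ?L"
  proof
    fix g assume "g \<in> a ` {1..d}"
    then obtain i where "i \<in> {1..d}" "g = a i" by blast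
    then have "g = letter_value [i]" "set [i] \<subseteq> {1..d}" using gen_closed by simp_all
    then show "g \<in> ?L" by blast
  qed
  ultimately show "carrier G \<subseteq> ?L"
    unfolding spinal_hanoi_group_def by (rule T.subgroup_generated_minimal)
qed

lemma carrier_G_syllable: "carrier G = word_value d a ` {\<gamma>. syllable_form d a \<gamma>}"
  unfolding carrier_G
proof (intro equalityI subsetI)
  fix g assume "g \<in> letter_value ` {w. set w \<subseteq> {1..d}}"
  then obtain w where w: "set w \<subseteq> {1..d}" "g = letter_value w" by blast
  then show "g \<in> word_value d a ` {\<gamma>. syllable_form d a \<gamma>}"
    using syllable_form_exists[OF w(1)] by force
next
  fix g assume "g \<in> word_value d a ` {\<gamma>. syllable_form d a \<gamma>}"
  then obtain \<gamma> where \<gamma>: "syllable_form d a \<gamma>" "g = word_value d a \<gamma>" by blast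
  then show "g \<in> letter_value ` {w. set w \<subseteq> {1..d}}"
    using letters_of_syllable_form[OF \<gamma>(1)] by force
qed

lemma comm_group_E: "comm_group E"
proof (rule group.group_comm_groupI)
  show "group E" by (simp add: exponent_group_def)
qed (auto simp: exponent_group_def add.commute)

lemma exponents_in_E: "exponents w \<in> carrier E"
  using gen_ord_gt_1
  by (force simp: exponents_def exponent_group_def carrier_integer_mod_group)

lemma abel_map_hom: "abel_map d a \<in> hom G E"
proof (rule homI)
  fix g assume "g \<in> carrier G"
  then obtain w where w: "set w \<subseteq> {1..d}" "g = letter_value w" by (auto simp: carrier_G)
  then show "abel_map d a g \<in> carrier E" by (simp add: abel_map_letter_value exponents_in_E)
  fix h assume "h \<in> carrier G"
  then obtain u where u: "set u \<subseteq> {1..d}" "h = letter_value u" by (auto simp: carrier_G)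
  have "exponents (w @ u) = exponents w \<otimes>\<^bsub>E\<^esub> exponents u"
    by (auto simp: exponents_def exponent_group_def fun_eq_iff mod_add_eq)
  moreover have "g \<otimes>\<^bsub>G\<^esub> h = letter_value (w @ u)" using w u letter_value_append by simp
  ultimately show "abel_map d a (g \<otimes>\<^bsub>G\<^esub> h) = abel_map d a g \<otimes>\<^bsub>E\<^esub> abel_map d a h"
    using abel_map_letter_value[of "w @ u"] w u by (simp add: abel_map_letter_value)
qed

sublocale abel: group_hom G E "abel_map d a"
  using group_G comm_group.axioms(2)[OF comm_group_E] abel_map_hom
  by (simp add: group_hom_def group_hom_axioms_def)

lemma abel_map_surj: "abel_map d a ` carrier G = carrier E"
proof
  show "abel_map d a ` carrier G \<subseteq> carrier E" using abel.hom_closed by (rule image_subsetI)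
  show "carrier E \<subseteq> abel_map d a ` carrier G"
  proof
    fix v assume v: "v \<in> carrier E"
    let ?w = "concat (map (\<lambda>j. replicate (nat (v j)) j) [1..<Suc d])"
    have w: "set ?w \<subseteq> {1..d}" by auto
    have cnt: "count_list (concat (map (\<lambda>j. replicate (nat (v j)) j) xs)) i =
        (if i \<in> set xs then nat (v i) else 0)" if "distinct xs" for xs i
      using that by (induction xs) (auto simp: count_list_replicate)
    have range: "0 \<le> v j \<and> v j < int (N j)" if "j \<in> {1..d}" for j
    proof -
      have "v j \<in> carrier (integer_mod_group (N j))"
        using v that by (simp add: exponent_group_def PiE_iff)
      then show ?thesis using gen_ord_gt_1[OF that] by (simp add: carrier_integer_mod_group)
    qed
    have "exponents ?w = v"
    proof
      fix j
      show "exponents ?w j = v j"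
      proof (cases "j \<in> {1..d}")
        case True
        then show ?thesis using range[OF True] cnt[of "[1..<Suc d]" j]
          by (simp add: exponents_def del: upt_Suc)
      next
        case False
        then show ?thesis
          using v unfolding exponents_def exponent_group_def carrier_product_group
          by (auto simp: PiE_iff extensional_def)
      qed
    qed
    then have "v = abel_map d a (letter_value ?w)" using abel_map_letter_value[OF w] by simp
    moreover have "letter_value ?w \<in> carrier G" unfolding carrier_G using w by (intro imageI) simp
    ultimately show "v \<in> abel_map d a ` carrier G" by (rule image_eqI)
  qed
qed

section \<open>The kernel and the abelianization\<close>

text \<open>In an abelian image only the exponent sums of a word matter.  Applied to the projection onto
  \<open>G/G'\<close>, this puts the kernel of \<open>\<epsilon>\<close> inside \<open>G'\<close>.\<close>

lemma hom_letter_value: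
  assumes H: "comm_group H" and hom: "\<phi> \<in> hom G H" and "set w \<subseteq> {1..d}"
  shows "\<phi> (letter_value w) =
    (\<Otimes>\<^bsub>H\<^esub>j\<in>{1..d}. \<phi> (a j) [^]\<^bsub>H\<^esub> count_list w j)"
  using assms(3)
proof -
  interpret H: comm_group H by (rule H)
  interpret \<phi>: group_hom G H \<phi>
    using group_G H.is_group hom by (simp add: group_hom_def group_hom_axioms_def)
  have \<phi>a: "\<phi> (a j) \<in> carrier H" if "j \<in> {1..d}" for j using gen_in_G[OF that] by simp
  show ?thesis using assms(3)
  proof (induction w)
    case Nil
    have "\<phi> (letter_value []) = \<one>\<^bsub>H\<^esub>" using \<phi>.hom_one by simp
    then show ?case by (simp add: H.finprod_one_eqI)
  next
    case (Cons i w)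
    then have i: "i \<in> {1..d}" and w: "set w \<subseteq> {1..d}" by auto
    have lw: "letter_value w \<in> carrier G" using w carrier_G by blast
    have "\<phi> (letter_value (i # w)) = \<phi> (a i) \<otimes>\<^bsub>H\<^esub> \<phi> (letter_value w)"
      using \<phi>.hom_mult[OF gen_in_G[OF i] lw] by simp
    also have "\<phi> (a i) = (\<Otimes>\<^bsub>H\<^esub>j\<in>{1..d}. if i = j then \<phi> (a j) else \<one>\<^bsub>H\<^esub>)"
      using i \<phi>a by (subst H.finprod_singleton) auto
    also have "\<dots> \<otimes>\<^bsub>H\<^esub> \<phi> (letter_value w) =
        (\<Otimes>\<^bsub>H\<^esub>j\<in>{1..d}. (if i = j then \<phi> (a j) else \<one>\<^bsub>H\<^esub>)
            \<otimes>\<^bsub>H\<^esub> \<phi> (a j) [^]\<^bsub>H\<^esub> count_list w j)"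
      unfolding Cons.IH[OF w] using \<phi>a by (subst H.finprod_multf) auto
    also have "\<dots> = (\<Otimes>\<^bsub>H\<^esub>j\<in>{1..d}. \<phi> (a j) [^]\<^bsub>H\<^esub> count_list (i # w) j)"
      using \<phi>a H.nat_pow_Suc2 by (intro H.finprod_cong') auto
    finally show ?case .
  qed
qed

lemma kernel_abel_map: "kernel G E (abel_map d a) = derived G (carrier G)"
proof
  interpret E: comm_group E by (rule comm_group_E)
  let ?D = "derived G (carrier G)"
  interpret D: normal ?D G by (rule abel.G.derived_self_is_normal)
  interpret Q: comm_group "G Mod ?D" by (rule abel.G.derived_quot_is_comm_group)
  show "?D \<subseteq> kernel G E (abel_map d a)"
  proof
    fix g assume g: "g \<in> ?D"
    have "abel_map d a ` ?D = derived E (carrier E)"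
      using abel.derived_img[of "carrier G"] by (simp add: abel_map_surj)
    then have "abel_map d a g = \<one>\<^bsub>E\<^esub>"
      using E.derived_eq_singleton[of "carrier E"] g by blast
    then show "g \<in> kernel G E (abel_map d a)"
      using g D.subset by (auto simp: kernel_def)
  qed
  show "kernel G E (abel_map d a) \<subseteq> ?D"
  proof
    fix g assume "g \<in> kernel G E (abel_map d a)"
    then have g: "g \<in> carrier G" "abel_map d a g = \<one>\<^bsub>E\<^esub>" by (auto simp: kernel_def)
    then obtain w where w: "set w \<subseteq> {1..d}" "g = letter_value w" by (auto simp: carrier_G)
    have dvd: "N j dvd count_list w j" if "j \<in> {1..d}" for j
    proof -
      have "exponents w j = \<one>\<^bsub>E\<^esub> j" using g(2) w by (simp add: abel_map_letter_value)
      then show ?thesis using that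
        by (simp add: exponents_def exponent_group_def mod_eq_0_iff_dvd)
    qed
    let ?\<pi> = "\<lambda>g. ?D #>\<^bsub>G\<^esub> g"
    have hom: "?\<pi> \<in> hom G (G Mod ?D)" by (rule D.r_coset_hom_Mod)
    interpret \<pi>: group_hom G "G Mod ?D" ?\<pi>
      using hom by (simp add: group_hom_def group_hom_axioms_def abel.G.is_group Q.is_group)
    have "?\<pi> (a j) [^]\<^bsub>G Mod ?D\<^esub> count_list w j = \<one>\<^bsub>G Mod ?D\<^esub>" if j: "j \<in> {1..d}" for j
    proof -
      have pow: "letter_value (replicate (count_list w j) j) = \<one>\<^bsub>G\<^esub>"
        using dvd[OF j] T.pow_eq_id[OF gen_closed[OF j]]
        by (simp add: letter_value_replicate[OF j] gen_ord_def)
      have "?\<pi> (a j) [^]\<^bsub>G Mod ?D\<^esub> count_list w j = ?\<pi> (a j [^]\<^bsub>G\<^esub> count_list w j)"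
        using gen_in_G[OF j] by (simp add: \<pi>.hom_nat_pow)
      also have "a j [^]\<^bsub>G\<^esub> count_list w j = \<one>\<^bsub>G\<^esub>"
        using pow by (simp add: letter_value_replicate[OF j] spinal_hanoi_group_def pow_subgroup_generated)
      finally show ?thesis using \<pi>.hom_one by simp
    qed
    then have "?\<pi> g = \<one>\<^bsub>G Mod ?D\<^esub>"
      unfolding w(2) hom_letter_value[OF Q.comm_group_axioms hom w(1)]
      by (intro Q.finprod_one_eqI) auto
    then have "?D #>\<^bsub>G\<^esub> g = ?D" by (simp add: FactGroup_def)
    then show "g \<in> ?D" using abel.G.rcos_self[OF g(1) D.subgroup_axioms] by simp
  qed
qed

end

theorem proposition3p8:
  fixes d :: nat
    and \<sigma> :: "nat \<Rightarrow> nat \<Rightarrow> nat"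
    and a :: "nat \<Rightarrow> (nat list \<Rightarrow> nat list)"
    and G :: "(nat list \<Rightarrow> nat list) monoid"
  assumes gens: "spinal_hanoi_generators d \<sigma> a"
    and G: "G = spinal_hanoi_group d a"
  shows "carrier G = word_value d a ` {\<gamma>. syllable_form d a \<gamma>}
    \<and> (\<forall>\<gamma> \<gamma>'. syllable_form d a \<gamma> \<longrightarrow> syllable_form d a \<gamma>' \<longrightarrow>
          word_value d a \<gamma> = word_value d a \<gamma>' \<longrightarrow>
          exponent_vector d a \<gamma> = exponent_vector d a \<gamma>')
    \<and> abel_map d a \<in> hom G (exponent_group d a)
    \<and> abel_map d a ` carrier G = carrier (exponent_group d a)
    \<and> kernel G (exponent_group d a) (abel_map d a) = derived G (carrier G)
    \<and> G Mod (derived G (carrier G)) \<cong> exponent_group d a"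
proof -
  interpret S: spinal_hanoi d \<sigma> a using gens by unfold_locales
  show ?thesis
    unfolding G
    using S.carrier_G_syllable S.exponent_vector_well_defined S.abel_map_hom S.abel_map_surj
      S.kernel_abel_map S.abel.FactGroup_iso[OF S.abel_map_surj, unfolded S.kernel_abel_map]
    by blast
qed

end
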